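(* $Div''_{n,d}$ is an open subset of $Div_{n,d}$.
   Context: $Div_{n,d}$ is the set of effective divisors of degree $d$ in $\mathbb{P}^n$ (homogeneous coordinates $x_0,\dots,x_n$, $n\geq 1$) defined by real homogeneous polynomials, identified via coefficients with $\mathbb{R}\mathbb{P}^{\binom{n+d}{d}-1}$ and given its standard topology. $Div'_{n,d}\subset Div_{n,d}$ is the subset of divisors defined by real polynomials of the form $G=x_0^d+\sum_{i_0+\cdots+i_n=d,\ i_0<d}c_{i_0,\dots,i_n}x_0^{i_0}\cdots x_n^{i_n}$. $E_{n,d}$ is the subset of $Div'_{n,d}$ of all $G$ such that for every $(x_1,\dots,x_n)\in\mathbb{R}^n\setminus\{0\}$, $G(x_0,x_1,\dots,x_n)$ as a polynomial in $x_0$ has $d$ distinct real roots. For $f\in Div'_{n,d}$ (normalized so that the coefficient of $x_0^d$ is 1) put $f_t(x_0,\dots,x_n)=t^df(\tfrac1t x_0,x_1,\dots,x_n)$. $Div''_{n,d}$ is the subset of $E_{n,d}$ of all $f$ such that $f_t(1,1,0,\dots,0)\neq 0$ for all $t\in(0,1]$. *)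

theory Defs
  imports "HOL-Analysis.Analysis"
begin

(* Exponent vectors (i_0, ..., i_n) of total degree d, extended by 0 beyond index n. *)
definition exponents :: "nat \<Rightarrow> nat \<Rightarrow> (nat \<Rightarrow> nat) set" where
  "exponents n d = {\<alpha>. (\<forall>i>n. \<alpha> i = 0) \<and> (\<Sum>i\<le>n. \<alpha> i) = d}"

(* A real form of degree d in x_0, ..., x_n is its family of coefficients, an element of
   R^(exponents n d); as usual for product_topology, families are extensional. *)
type_synonym form = "(nat \<Rightarrow> nat) \<Rightarrow> real"

definition form_topology :: "nat \<Rightarrow> nat \<Rightarrow> form topology" where
  "form_topology n d = product_topology (\<lambda>_. euclideanreal) (exponents n d)"

definition nonzero_forms :: "nat \<Rightarrow> nat \<Rightarrow> form set" where
  "nonzero_forms n d = {c \<in> topspace (form_topology n d). \<exists>\<alpha>\<in>exponents n d. c \<alpha> \<noteq> 0}"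

(* Only the coordinates x 0, ..., x n matter. *)
definition eval_form :: "nat \<Rightarrow> nat \<Rightarrow> form \<Rightarrow> (nat \<Rightarrow> real) \<Rightarrow> real" where
  "eval_form n d c x = (\<Sum>\<alpha>\<in>exponents n d. c \<alpha> * (\<Prod>i\<le>n. x i ^ \<alpha> i))"

definition proportional :: "nat \<Rightarrow> nat \<Rightarrow> (form \<times> form) set" where
  "proportional n d = {(c, c'). c \<in> nonzero_forms n d \<and> c' \<in> nonzero_forms n d \<and>
     (\<exists>r. r \<noteq> 0 \<and> (\<forall>\<alpha>\<in>exponents n d. c' \<alpha> = r * c \<alpha>))}"

(* An effective divisor given by a real form is that form up to a nonzero scalar, i.e. a
   point of the real projective space of the coefficient space. *)
definition Div :: "nat \<Rightarrow> nat \<Rightarrow> form set set" where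
  "Div n d = nonzero_forms n d // proportional n d"

(* The quotient topology of projective space; see quotient_map_Div below. *)
definition Div_topology :: "nat \<Rightarrow> nat \<Rightarrow> form set topology" where
  "Div_topology n d = topology (\<lambda>U. U \<subseteq> Div n d \<and>
     openin (subtopology (form_topology n d) (nonzero_forms n d))
       {c \<in> nonzero_forms n d. proportional n d `` {c} \<in> U})"

(* Exponent vector of x_0^d. *)
definition top_exponent :: "nat \<Rightarrow> nat \<Rightarrow> nat" where
  "top_exponent d = (\<lambda>i. if i = 0 then d else 0)"

definition Div' :: "nat \<Rightarrow> nat \<Rightarrow> form set set" where
  "Div' n d = {D \<in> Div n d. \<exists>G\<in>D. G (top_exponent d) = 1}"

(* The representative x_0^d + ... of an element of Div'; it is unique by ex1_normalized. *)
definition normalized :: "nat \<Rightarrow> form set \<Rightarrow> form" where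
  "normalized d D = (THE G. G \<in> D \<and> G (top_exponent d) = 1)"

(* The point (x_1, ..., x_n) is given by the values of x on {1..n}; x 0 is overwritten.
   As a polynomial in x_0, G is monic of degree d. *)
definition E_div :: "nat \<Rightarrow> nat \<Rightarrow> form set set" where
  "E_div n d = {D \<in> Div' n d. \<forall>x :: nat \<Rightarrow> real. (\<exists>i\<in>{1..n}. x i \<noteq> 0) \<longrightarrow>
     (let Z = {s. eval_form n d (normalized d D) (x(0 := s)) = 0} in finite Z \<and> card Z = d)}"

definition rescale :: "nat \<Rightarrow> nat \<Rightarrow> form \<Rightarrow> real \<Rightarrow> (nat \<Rightarrow> real) \<Rightarrow> real" where
  "rescale n d f t x = t ^ d * eval_form n d f (x(0 := (1 / t) * x 0))"

definition Div'' :: "nat \<Rightarrow> nat \<Rightarrow> form set set" where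
  "Div'' n d = {D \<in> E_div n d. \<forall>t\<in>{0<..1}.
     rescale n d (normalized d D) t (\<lambda>i. if i = 0 \<or> i = 1 then 1 else 0) \<noteq> 0}"

lemma equiv_proportional: "equiv (nonzero_forms n d) (proportional n d)"
proof (rule equivI)
  show "proportional n d \<subseteq> nonzero_forms n d \<times> nonzero_forms n d"
    by (auto simp: proportional_def)
  show "refl_on (nonzero_forms n d) (proportional n d)"
    by (auto simp: refl_on_def proportional_def intro!: exI[of _ 1])
  show "sym (proportional n d)"
  proof (rule symI)
    fix a b assume "(a, b) \<in> proportional n d"
    then obtain r where "r \<noteq> 0" "\<forall>\<alpha>\<in>exponents n d. b \<alpha> = r * a \<alpha>"
      and "a \<in> nonzero_forms n d" "b \<in> nonzero_forms n d"
      by (auto simp: proportional_def)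
    then show "(b, a) \<in> proportional n d"
      by (auto simp: proportional_def intro!: exI[of _ "inverse r"])
  qed
  show "trans (proportional n d)"
  proof (rule transI)
    fix a b c assume "(a, b) \<in> proportional n d" "(b, c) \<in> proportional n d"
    then obtain r s where "r \<noteq> 0" "\<forall>\<alpha>\<in>exponents n d. b \<alpha> = r * a \<alpha>"
      "s \<noteq> 0" "\<forall>\<alpha>\<in>exponents n d. c \<alpha> = s * b \<alpha>"
      "a \<in> nonzero_forms n d" "c \<in> nonzero_forms n d"
      by (auto simp: proportional_def)
    then show "(a, c) \<in> proportional n d"
      by (auto simp: proportional_def intro!: exI[of _ "s * r"])
  qed
qed

lemma openin_Div_topology:
  "openin (Div_topology n d) U \<longleftrightarrow> U \<subseteq> Div n d \<and>
     openin (subtopology (form_topology n d) (nonzero_forms n d))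
       {c \<in> nonzero_forms n d. proportional n d `` {c} \<in> U}"
proof -
  let ?T = "subtopology (form_topology n d) (nonzero_forms n d)"
  let ?pre = "\<lambda>U. {c \<in> nonzero_forms n d. proportional n d `` {c} \<in> U}"
  have "istopology (\<lambda>U. U \<subseteq> Div n d \<and> openin ?T (?pre U))"
    unfolding istopology_def
  proof (intro conjI allI impI)
    fix S T assume "S \<subseteq> Div n d \<and> openin ?T (?pre S)" "T \<subseteq> Div n d \<and> openin ?T (?pre T)"
    moreover have "?pre (S \<inter> T) = ?pre S \<inter> ?pre T" by auto
    ultimately show "S \<inter> T \<subseteq> Div n d" "openin ?T (?pre (S \<inter> T))" by auto
  next
    fix K assume K: "\<forall>S\<in>K. S \<subseteq> Div n d \<and> openin ?T (?pre S)"
    then show "\<Union>K \<subseteq> Div n d" by auto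
    have "?pre (\<Union>K) = \<Union>(?pre ` K)" by auto
    then show "openin ?T (?pre (\<Union>K))" using K by auto
  qed
  then show ?thesis by (simp add: Div_topology_def)
qed

lemma topspace_nonzero_forms:
  "topspace (subtopology (form_topology n d) (nonzero_forms n d)) = nonzero_forms n d"
  by (auto simp: nonzero_forms_def)

lemma topspace_Div_topology [simp]: "topspace (Div_topology n d) = Div n d"
proof -
  have "{c \<in> nonzero_forms n d. proportional n d `` {c} \<in> Div n d} = nonzero_forms n d"
    by (auto simp: Div_def quotientI)
  then have "openin (Div_topology n d) (Div n d)"
    unfolding openin_Div_topology
    by (metis openin_topspace order_refl topspace_nonzero_forms)
  then show ?thesis
    by (metis openin_Div_topology openin_subset openin_topspace subset_antisym)
qed

lemma quotient_map_Div:
  "quotient_map (subtopology (form_topology n d) (nonzero_forms n d)) (Div_topology n d)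
     (\<lambda>c. proportional n d `` {c})"
  unfolding quotient_map_def topspace_nonzero_forms topspace_Div_topology openin_Div_topology
  by (auto simp: Div_def quotient_def)

lemma ex1_normalized:
  assumes "D \<in> Div' n d"
  shows "\<exists>!G. G \<in> D \<and> G (top_exponent d) = 1"
proof -
  have top: "top_exponent d \<in> exponents n d"
    by (auto simp: top_exponent_def exponents_def)
  have D: "D \<in> nonzero_forms n d // proportional n d"
    using assms by (simp add: Div'_def Div_def)
  have "G = H" if "G \<in> D" "G (top_exponent d) = 1" "H \<in> D" "H (top_exponent d) = 1" for G H
  proof -
    have "(G, H) \<in> proportional n d"
      using quotient_eq_iff[OF equiv_proportional D D that(1,3)] by simp
    then obtain r where r: "\<forall>\<alpha>\<in>exponents n d. H \<alpha> = r * G \<alpha>"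
      and nz: "G \<in> nonzero_forms n d" "H \<in> nonzero_forms n d"
      by (auto simp: proportional_def)
    have "r = 1" using r top that by auto
    then have "\<forall>\<alpha>\<in>exponents n d. G \<alpha> = H \<alpha>" using r by simp
    moreover have "G \<in> extensional (exponents n d)" "H \<in> extensional (exponents n d)"
      using nz by (auto simp: nonzero_forms_def form_topology_def PiE_def)
    ultimately show "G = H" by (meson extensionalityI)
  qed
  then show ?thesis using assms by (auto simp: Div'_def)
qed

end

theory Submission
  imports Defs
begin

text \<open>
  For a nonzero form \<open>c\<close> with divisor \<open>D\<close>, membership of \<open>D\<close> in \<^term>\<open>Div'' n d\<close> does not depend
  on the scaling of \<open>c\<close>, so it can be expressed through \<open>c\<close> itself. It then reads: for every
  \<open>(x\<^sub>1, \<dots>, x\<^sub>n)\<close> in a fixed compact sphere the polynomial \<open>c (s, x\<^sub>1, \<dots>, x\<^sub>n)\<close> in \<open>s\<close> has degree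
  \<open>d\<close> and \<open>d\<close> distinct real roots, and \<open>c (1, t, 0, \<dots>, 0) \<noteq> 0\<close> for every \<open>t \<in> [0, 1]\<close>. The sphere
  suffices because \<open>c\<close> is homogeneous, so scaling \<open>x\<close> only scales the roots. The second condition
  comes from \<open>t\<^sup>d c (1/t, 1, 0, \<dots>, 0) = c (1, t, 0, \<dots>, 0)\<close>; the value \<open>t = 0\<close>, which makes the
  interval compact, says that the coefficient of \<open>x\<^sub>0\<^sup>d\<close> is nonzero, i.e. that \<open>D\<close> lies in
  \<^term>\<open>Div' n d\<close> (\<open>good_forms_iff\<close>, \<open>class_in_Div''_iff\<close>).

  Both are conditions on pairs (form, point of a compact set), required for all points of the
  compact set. Each is open in the pair, hence by the tube lemma (\<open>open_Ball_compact\<close>) it defines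
  an open set of forms. The only point that needs an argument is that having \<open>d\<close> distinct real
  roots is open among real polynomials of degree \<open>d\<close> (\<open>open_real_rooted\<close>): such a polynomial
  changes sign around each of its roots (\<open>simple_roots_sign_changes\<close>), finitely many strict
  inequalities record these changes, and conversely the sign changes yield \<open>d\<close> roots by the
  intermediate value theorem (\<open>card_roots_of_sign_changes\<close>).
\<close>

section \<open>Real polynomials with the maximal number of real roots\<close>

lemma finite_separation:
  fixes Z :: "real set"
  assumes "finite Z"
  obtains e where "e > 0" "\<And>r r'. r \<in> Z \<Longrightarrow> r' \<in> Z \<Longrightarrow> r \<noteq> r' \<Longrightarrow> 2 * e < \<bar>r - r'\<bar>"
proof -
  define A where "A = insert 1 ((\<lambda>(r, r'). \<bar>r - r'\<bar>) ` {(r, r') \<in> Z \<times> Z. r \<noteq> r'})"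
  have "finite {(r, r') \<in> Z \<times> Z. r \<noteq> r'}"
    by (rule finite_subset[of _ "Z \<times> Z"]) (use assms in auto)
  then have A: "finite A" "A \<noteq> {}" by (auto simp: A_def)
  have pos: "Min A > 0"
    using A by (subst Min_gr_iff) (auto simp: A_def)
  show ?thesis
  proof (rule that[of "Min A / 3"])
    show "Min A / 3 > 0" using pos by simp
    fix r r' assume "r \<in> Z" "r' \<in> Z" "r \<noteq> r'"
    then have "\<bar>r - r'\<bar> \<in> A" by (force simp: A_def)
    then have "Min A \<le> \<bar>r - r'\<bar>" using A by simp
    then show "2 * (Min A / 3) < \<bar>r - r'\<bar>" using pos by linarith
  qed
qed

lemma poly_eq_prod_roots:
  fixes p :: "real poly"
  assumes "finite Z" "degree p = card Z" "\<And>r. r \<in> Z \<Longrightarrow> poly p r = 0"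
  shows "p = smult (lead_coeff p) (\<Prod>r\<in>Z. [:-r, 1:])"
proof (rule poly_eqI_degree_lead_coeff[where n = "card Z" and A = Z])
  let ?q = "\<Prod>r\<in>Z. [:-r, 1:]"
  have deg: "degree ?q = card Z" by (simp add: degree_prod_eq_sum_degree)
  have lc: "lead_coeff ?q = 1" by (simp add: lead_coeff_prod)
  show "coeff p (card Z) = coeff (smult (lead_coeff p) ?q) (card Z)"
    using deg lc assms(2) by simp
  show "degree p \<le> card Z" "degree (smult (lead_coeff p) ?q) \<le> card Z"
    using assms(2) deg by auto
  show "poly p z = poly (smult (lead_coeff p) ?q) z" if "z \<in> Z" for z
    using that assms by (auto simp: poly_prod prod_zero_iff)
qed auto

text \<open>
  With \<open>p = c \<Prod>\<^sub>r (X - r)\<close>, the product \<open>p (a - e) p (a + e)\<close> is \<open>c\<^sup>2 \<Prod>\<^sub>r ((a - r)\<^sup>2 - e\<^sup>2)\<close>, in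
  which only the factor for \<open>r = a\<close> is negative.
\<close>

lemma simple_roots_sign_changes:
  fixes p :: "real poly"
  assumes "p \<noteq> 0" "finite Z" "degree p = card Z" "\<And>r. r \<in> Z \<Longrightarrow> poly p r = 0"
    and "e > 0" "\<And>r r'. r \<in> Z \<Longrightarrow> r' \<in> Z \<Longrightarrow> r \<noteq> r' \<Longrightarrow> 2 * e < \<bar>r - r'\<bar>"
    and "a \<in> Z"
  shows "poly p (a - e) * poly p (a + e) < 0"
proof -
  let ?c = "lead_coeff p"
  have p: "poly p x = ?c * (\<Prod>r\<in>Z. x - r)" for x
    by (subst poly_eq_prod_roots[OF assms(2-4)]) (simp_all add: poly_prod)
  have "(\<Prod>r\<in>Z. a - e - r) * (\<Prod>r\<in>Z. a + e - r) = (\<Prod>r\<in>Z. (a - r)\<^sup>2 - e\<^sup>2)"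
    by (simp add: prod.distrib[symmetric] power2_eq_square algebra_simps)
  also have "\<dots> = - (e\<^sup>2) * (\<Prod>r\<in>Z - {a}. (a - r)\<^sup>2 - e\<^sup>2)"
    using assms(2,7) by (simp add: prod.remove[of _ a])
  also have "\<dots> < 0"
  proof -
    have "(\<Prod>r\<in>Z - {a}. (a - r)\<^sup>2 - e\<^sup>2) > 0"
    proof (rule prod_pos)
      fix r assume "r \<in> Z - {a}"
      then have "2 * e < \<bar>a - r\<bar>" using assms(6)[of a r] assms(7) by auto
      then have "\<bar>e\<bar> < \<bar>a - r\<bar>" using assms(5) by linarith
      then show "0 < (a - r)\<^sup>2 - e\<^sup>2" using abs_le_square_iff[of "a - r" e] by linarith
    qed
    then show ?thesis using assms(5) by (simp add: mult_less_0_iff)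
  qed
  finally have "(\<Prod>r\<in>Z. a - e - r) * (\<Prod>r\<in>Z. a + e - r) < 0" .
  moreover have "?c\<^sup>2 > 0" using assms(1) by simp
  moreover have "poly p (a - e) * poly p (a + e) =
      ?c\<^sup>2 * ((\<Prod>r\<in>Z. a - e - r) * (\<Prod>r\<in>Z. a + e - r))"
    by (simp add: p power2_eq_square)
  ultimately show ?thesis by (simp add: mult_less_0_iff)
qed

text \<open>The gap condition makes the intervals \<open>(r - e, r + e)\<close> disjoint, so their roots are distinct.\<close>

lemma card_roots_of_sign_changes:
  fixes p :: "real poly"
  assumes "p \<noteq> 0" "degree p \<le> card Z"
    and "e > 0" "\<And>r r'. r \<in> Z \<Longrightarrow> r' \<in> Z \<Longrightarrow> r \<noteq> r' \<Longrightarrow> 2 * e < \<bar>r - r'\<bar>"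
    and "\<And>r. r \<in> Z \<Longrightarrow> poly p (r - e) * poly p (r + e) < 0"
  shows "card {s. poly p s = 0} = card Z"
proof (rule antisym)
  show "card {s. poly p s = 0} \<le> card Z"
    using card_poly_roots_bound[OF assms(1)] assms(2) by linarith
  have "\<exists>s. r - e < s \<and> s < r + e \<and> poly p s = 0" if "r \<in> Z" for r
    using poly_IVT[of "r - e" "r + e" p] assms(3) assms(5)[OF that] by auto
  then obtain f where f: "\<And>r. r \<in> Z \<Longrightarrow> r - e < f r \<and> f r < r + e \<and> poly p (f r) = 0"
    by metis
  have "inj_on f Z"
  proof (rule inj_onI, rule ccontr)
    fix r r' assume "r \<in> Z" "r' \<in> Z" "f r = f r'" "r \<noteq> r'"
    then show False using f[of r] f[of r'] assms(4)[of r r'] by linarith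
  qed
  then show "card Z \<le> card {s. poly p s = 0}"
    by (rule card_inj_on_le) (use f poly_roots_finite[OF assms(1)] in auto)
qed

section \<open>Evaluation of forms\<close>

lemma finite_exponents: "finite (exponents n d)"
proof (rule finite_subset)
  show "exponents n d \<subseteq> {f. \<forall>x. (x \<in> {..n} \<longrightarrow> f x \<in> {..d}) \<and> (x \<notin> {..n} \<longrightarrow> f x = 0)}"
  proof
    fix \<alpha> assume \<alpha>: "\<alpha> \<in> exponents n d"
    then have "\<alpha> i \<le> d" if "i \<le> n" for i
      using member_le_sum[of i "{..n}" \<alpha>] that by (auto simp: exponents_def)
    then show "\<alpha> \<in> {f. \<forall>x. (x \<in> {..n} \<longrightarrow> f x \<in> {..d}) \<and> (x \<notin> {..n} \<longrightarrow> f x = 0)}"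
      using \<alpha> by (auto simp: exponents_def)
  qed
  show "finite {f :: nat \<Rightarrow> nat. \<forall>x. (x \<in> {..n} \<longrightarrow> f x \<in> {..d}) \<and> (x \<notin> {..n} \<longrightarrow> f x = 0)}"
    by (rule finite_set_of_finite_funs) auto
qed

lemma top_exponent_in_exponents: "top_exponent d \<in> exponents n d"
  by (auto simp: top_exponent_def exponents_def)

lemma exponents_le:
  assumes "\<alpha> \<in> exponents n d"
  shows "\<alpha> 0 \<le> d"
  using assms member_le_sum[of 0 "{..n}" \<alpha>] by (auto simp: exponents_def)

lemma exponents_eq_top:
  assumes "\<alpha> \<in> exponents n d" "\<alpha> 0 = d"
  shows "\<alpha> = top_exponent d"
proof
  have "d = \<alpha> 0 + (\<Sum>i\<in>{..n} - {0}. \<alpha> i)"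
    using assms(1) by (subst sum.remove[symmetric]) (auto simp: exponents_def)
  then have "\<forall>i\<in>{..n} - {0}. \<alpha> i = 0" using assms(2) by simp
  then show "\<alpha> i = top_exponent d i" for i
    using assms by (cases "i \<le> n") (auto simp: exponents_def top_exponent_def)
qed

lemma continuous_eval_form [continuous_intros]:
  fixes f :: "'a::topological_space \<Rightarrow> form" and g :: "'a \<Rightarrow> nat \<Rightarrow> real"
  assumes "\<And>\<alpha>. continuous_on S (\<lambda>z. f z \<alpha>)" "\<And>i. continuous_on S (\<lambda>z. g z i)"
  shows "continuous_on S (\<lambda>z. eval_form n d (f z) (g z))"
  unfolding eval_form_def by (intro continuous_intros assms)

lemma eval_form_homogeneous: "eval_form n d c (\<lambda>i. l * x i) = l ^ d * eval_form n d c x"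
proof -
  have "(\<Prod>i\<le>n. (l * x i) ^ \<alpha> i) = l ^ d * (\<Prod>i\<le>n. x i ^ \<alpha> i)" if "\<alpha> \<in> exponents n d" for \<alpha>
    using that by (simp add: power_mult_distrib prod.distrib power_sum[symmetric] exponents_def)
  then show ?thesis
    by (simp add: eval_form_def sum_distrib_left mult.left_commute)
qed

lemma eval_form_scale:
  assumes "\<And>\<alpha>. \<alpha> \<in> exponents n d \<Longrightarrow> c' \<alpha> = r * c \<alpha>"
  shows "eval_form n d c' x = r * eval_form n d c x"
  using assms by (simp add: eval_form_def sum_distrib_left mult.assoc)

lemma eval_form_axis:
  assumes "\<And>i. 1 \<le> i \<Longrightarrow> i \<le> n \<Longrightarrow> x i = 0"
  shows "eval_form n d c x = c (top_exponent d) * x 0 ^ d"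
proof -
  have "c \<alpha> * (\<Prod>i\<le>n. x i ^ \<alpha> i) = 0" if "\<alpha> \<in> exponents n d - {top_exponent d}" for \<alpha>
  proof -
    have "\<exists>i\<in>{1..n}. \<alpha> i \<noteq> 0"
    proof (rule ccontr)
      assume "\<not> (\<exists>i\<in>{1..n}. \<alpha> i \<noteq> 0)"
      then have "(\<Sum>i\<in>{..n} - {0}. \<alpha> i) = 0" by (intro sum.neutral) auto
      moreover have "d = \<alpha> 0 + (\<Sum>i\<in>{..n} - {0}. \<alpha> i)"
        using that by (subst sum.remove[symmetric]) (auto simp: exponents_def)
      ultimately have "\<alpha> 0 = d" by linarith
      then show False using exponents_eq_top that by blast
    qed
    then obtain i where "i \<in> {1..n}" "\<alpha> i \<noteq> 0" by blast
    then have "(\<Prod>i\<le>n. x i ^ \<alpha> i) = 0"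
      using assms[of i] by (intro prod_zero) (auto intro!: bexI[of _ i])
    then show ?thesis by simp
  qed
  then have "(\<Sum>\<alpha>\<in>exponents n d - {top_exponent d}. c \<alpha> * (\<Prod>i\<le>n. x i ^ \<alpha> i)) = 0"
    by (rule sum.neutral[OF ballI])
  then have "eval_form n d c x = c (top_exponent d) * (\<Prod>i\<le>n. x i ^ top_exponent d i)"
    using sum.remove[OF finite_exponents top_exponent_in_exponents,
        of "\<lambda>\<alpha>. c \<alpha> * (\<Prod>i\<le>n. x i ^ \<alpha> i)" n d]
    by (simp only: eval_form_def add_0_right)
  also have "(\<Prod>i\<le>n. x i ^ top_exponent d i) = x 0 ^ d"
    by (subst prod.remove[of _ 0]) (auto simp: top_exponent_def intro!: prod.neutral)
  finally show ?thesis .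
qed

text \<open>The form \<open>c\<close> at \<open>(s, x\<^sub>1, \<dots>, x\<^sub>n)\<close> as a polynomial in \<open>s\<close>; the value \<open>x 0\<close> is not used.\<close>

definition form_poly :: "nat \<Rightarrow> nat \<Rightarrow> form \<Rightarrow> (nat \<Rightarrow> real) \<Rightarrow> real poly" where
  "form_poly n d c x = (\<Sum>\<alpha>\<in>exponents n d. monom (c \<alpha> * (\<Prod>i\<in>{..n} - {0}. x i ^ \<alpha> i)) (\<alpha> 0))"

lemma poly_form_poly: "poly (form_poly n d c x) s = eval_form n d c (x(0 := s))"
  unfolding form_poly_def eval_form_def poly_sum poly_monom
proof (rule sum.cong[OF refl])
  fix \<alpha>
  have "(\<Prod>i\<le>n. (x(0 := s)) i ^ \<alpha> i) = s ^ \<alpha> 0 * (\<Prod>i\<in>{..n} - {0}. x i ^ \<alpha> i)"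
    by (subst prod.remove[of _ 0]) auto
  then show "c \<alpha> * (\<Prod>i\<in>{..n} - {0}. x i ^ \<alpha> i) * s ^ \<alpha> 0 =
      c \<alpha> * (\<Prod>i\<le>n. (x(0 := s)) i ^ \<alpha> i)"
    by simp
qed

lemma degree_form_poly_le: "degree (form_poly n d c x) \<le> d"
  unfolding form_poly_def
  by (intro degree_sum_le finite_exponents order.trans[OF degree_monom_le] exponents_le)

lemma coeff_form_poly: "coeff (form_poly n d c x) d = c (top_exponent d)"
proof -
  have "coeff (form_poly n d c x) d =
      (\<Sum>\<alpha>\<in>exponents n d. if \<alpha> = top_exponent d then c \<alpha> else 0)"
    unfolding form_poly_def coeff_sum
  proof (rule sum.cong[OF refl])
    fix \<alpha> assume \<alpha>: "\<alpha> \<in> exponents n d"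
    have "(\<Prod>i\<in>{..n} - {0}. x i ^ top_exponent d i) = 1"
      by (intro prod.neutral) (auto simp: top_exponent_def)
    moreover have "\<alpha> 0 = d \<longleftrightarrow> \<alpha> = top_exponent d"
      using exponents_eq_top[OF \<alpha>] by (metis top_exponent_def)
    ultimately show "coeff (monom (c \<alpha> * (\<Prod>i\<in>{..n} - {0}. x i ^ \<alpha> i)) (\<alpha> 0)) d =
        (if \<alpha> = top_exponent d then c \<alpha> else 0)"
      by (cases "\<alpha> = top_exponent d") simp_all
  qed
  then show ?thesis
    by (simp add: finite_exponents top_exponent_in_exponents)
qed

lemma form_poly_nonzero:
  assumes "c (top_exponent d) \<noteq> 0"
  shows "form_poly n d c x \<noteq> 0" "degree (form_poly n d c x) = d"
proof -
  have "coeff (form_poly n d c x) d \<noteq> 0" using assms by (simp add: coeff_form_poly)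
  then show "form_poly n d c x \<noteq> 0" "degree (form_poly n d c x) = d"
    using degree_form_poly_le[of n d c x] le_degree[of "form_poly n d c x" d] by auto
qed

section \<open>Openness on the space of forms\<close>

text \<open>
  Here forms carry the product topology of the whole function type; \<open>openin_form_topology\<close> below
  transfers open sets to \<^const>\<open>form_topology\<close>.
\<close>

lemma open_Ball_compact:
  assumes "compact K" "open W"
  shows "open {c. \<forall>k\<in>K. (c, k) \<in> W}"
proof (subst open_subopen, intro ballI)
  fix c assume "c \<in> {c. \<forall>k\<in>K. (c, k) \<in> W}"
  then have "{c} \<times> K \<subseteq> W" by auto
  from Elementary_Topology.tube_lemma[OF assms this]
  obtain X where "c \<in> X" "open X" "X \<times> K \<subseteq> W" by auto
  then show "\<exists>T. open T \<and> c \<in> T \<and> T \<subseteq> {c. \<forall>k\<in>K. (c, k) \<in> W}"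
    by (intro exI[of _ X]) auto
qed

text \<open>
  The pairs of a form \<open>c\<close> and a point \<open>x\<close> for which \<open>c (s, x\<^sub>1, \<dots>, x\<^sub>n)\<close> has degree \<open>d\<close> and \<open>d\<close>
  distinct real roots in \<open>s\<close>. Since the leading coefficient is nonzero, the root set is finite
  and its cardinality is meaningful also for \<open>d = 0\<close>.
\<close>

definition real_rooted_pairs :: "nat \<Rightarrow> nat \<Rightarrow> (form \<times> (nat \<Rightarrow> real)) set" where
  "real_rooted_pairs n d = {(c, x). c (top_exponent d) \<noteq> 0 \<and>
     card {s. eval_form n d c (x(0 := s)) = 0} = d}"

lemma continuous_on_fst_apply [continuous_intros]:
  "continuous_on S (\<lambda>z. fst z a)" for S :: "(('a \<Rightarrow> 'b::topological_space) \<times> 'c::topological_space) set"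
  by (rule continuous_on_product_then_coordinatewise) (intro continuous_intros)

lemma continuous_on_snd_apply [continuous_intros]:
  "continuous_on S (\<lambda>z. snd z a)" for S :: "('c::topological_space \<times> ('a \<Rightarrow> 'b::topological_space)) set"
  by (rule continuous_on_product_then_coordinatewise) (intro continuous_intros)

lemma open_real_rooted: "open (real_rooted_pairs n d)"
proof (subst open_subopen, intro ballI)
  fix z assume z: "z \<in> real_rooted_pairs n d"
  obtain c x where zcx: "z = (c, x)" by (cases z)
  let ?p = "\<lambda>z. form_poly n d (fst z) (snd z)"
  define Z where "Z = {s. poly (?p z) s = 0}"
  have top: "fst z (top_exponent d) \<noteq> 0" and card: "card Z = d"
    using z by (auto simp: real_rooted_pairs_def Z_def poly_form_poly zcx)
  note nz = form_poly_nonzero[of "fst z" d n "snd z", OF top]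
  have fin: "finite Z" unfolding Z_def using nz(1) by (rule poly_roots_finite)
  \<comment> \<open>The neighbourhood \<open>T\<close> of \<open>z\<close> keeps the signs at \<open>r - e\<close> and \<open>r + e\<close> opposite for each root \<open>r\<close>.\<close>
  obtain e where e: "e > 0" "\<And>r r'. r \<in> Z \<Longrightarrow> r' \<in> Z \<Longrightarrow> r \<noteq> r' \<Longrightarrow> 2 * e < \<bar>r - r'\<bar>"
    using finite_separation[OF fin] by blast
  define T where "T = {y. fst y (top_exponent d) \<noteq> 0} \<inter>
    (\<Inter>r\<in>Z. {y. poly (?p y) (r - e) * poly (?p y) (r + e) < 0})"
  have cont: "continuous_on UNIV (\<lambda>y. poly (?p y) s)" for s
    unfolding poly_form_poly
  proof (intro continuous_intros)
    show "continuous_on UNIV (\<lambda>y. ((snd y)(0 := s)) i)" for i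
      by (cases "i = 0") (auto intro!: continuous_intros)
  qed
  have "open T"
    unfolding T_def
    by (intro open_Int open_INT fin ballI open_Collect_less open_Collect_neq continuous_intros cont)
  moreover have "z \<in> T"
  proof -
    have "poly (?p z) (r - e) * poly (?p z) (r + e) < 0" if "r \<in> Z" for r
      by (rule simple_roots_sign_changes[OF nz(1) fin _ _ e that])
        (use nz(2) card in \<open>auto simp: Z_def\<close>)
    then show ?thesis using top by (simp add: T_def)
  qed
  moreover have "T \<subseteq> real_rooted_pairs n d"
  proof
    fix y assume y: "y \<in> T"
    then have top': "fst y (top_exponent d) \<noteq> 0" by (simp add: T_def)
    note nz' = form_poly_nonzero[of "fst y" d n "snd y", OF top']
    have "card {s. poly (?p y) s = 0} = card Z"
      by (rule card_roots_of_sign_changes[OF nz'(1) _ e]) (use y nz'(2) card in \<open>auto simp: T_def\<close>)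
    then show "y \<in> real_rooted_pairs n d"
      using top' card by (cases y) (auto simp: real_rooted_pairs_def poly_form_poly)
  qed
  ultimately show "\<exists>T. open T \<and> z \<in> T \<and> T \<subseteq> real_rooted_pairs n d" by blast
qed

text \<open>
  The unit sphere of the maximum norm in the coordinates \<open>x\<^sub>1, \<dots>, x\<^sub>n\<close>; all other coordinates
  are set to 0, which makes it a compact subset of the full function space.
\<close>

definition max_sphere :: "nat \<Rightarrow> (nat \<Rightarrow> real) set" where
  "max_sphere n = {x. (\<forall>i. x i \<in> (if i \<in> {1..n} then {-1..1} else {0})) \<and> (\<exists>i\<in>{1..n}. \<bar>x i\<bar> = 1)}"

lemma compact_max_sphere: "compact (max_sphere n)"
proof -
  let ?B = "\<lambda>i::nat. if i \<in> {1..n} then {-1..1} else {0::real}"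
  have "compactin (product_topology (\<lambda>_. euclidean) UNIV) (PiE UNIV ?B)"
    by (subst compactin_PiE) auto
  then have "compact (PiE UNIV ?B)"
    by (simp add: euclidean_product_topology)
  moreover have "closed (\<Union>i\<in>{1..n}. {x :: nat \<Rightarrow> real. \<bar>x i\<bar> = 1})"
    by (intro closed_UN ballI closed_Collect_eq continuous_intros) auto
  moreover have "max_sphere n = PiE UNIV ?B \<inter> (\<Union>i\<in>{1..n}. {x. \<bar>x i\<bar> = 1})"
    unfolding max_sphere_def PiE_UNIV_domain Pi_def by blast
  ultimately show ?thesis by (metis compact_Int_closed)
qed

lemma scaled_to_max_sphere:
  fixes x :: "nat \<Rightarrow> real"
  assumes "\<exists>i\<in>{1..n}. x i \<noteq> 0"
  obtains l y where "l > 0" "y \<in> max_sphere n" "\<And>i. i \<in> {1..n} \<Longrightarrow> x i = l * y i"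
proof -
  define l where "l = Max ((\<lambda>i. \<bar>x i\<bar>) ` {1..n})"
  have ne: "(\<lambda>i. \<bar>x i\<bar>) ` {1..n} \<noteq> {}" using assms by auto
  have le: "\<bar>x i\<bar> \<le> l" if "i \<in> {1..n}" for i using that by (auto simp: l_def intro!: Max_ge)
  have "l \<in> (\<lambda>i. \<bar>x i\<bar>) ` {1..n}" unfolding l_def using ne by (intro Max_in) auto
  then obtain j where j: "j \<in> {1..n}" "\<bar>x j\<bar> = l" by auto
  obtain i where "i \<in> {1..n}" "x i \<noteq> 0" using assms by blast
  then have pos: "l > 0" using le[of i] by linarith
  show ?thesis
  proof (rule that[OF pos, of "\<lambda>i. if i \<in> {1..n} then x i / l else 0"])
    have "x i / l \<in> {-1..1}" if "i \<in> {1..n}" for i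
      using le[OF that] pos by (auto simp: field_simps abs_le_iff)
    moreover have "\<bar>x j / l\<bar> = 1" using j pos by simp
    ultimately show "(\<lambda>i. if i \<in> {1..n} then x i / l else 0) \<in> max_sphere n"
      using j(1) unfolding max_sphere_def by auto
  qed (use pos in auto)
qed

lemma card_roots_scale:
  assumes "l > 0" "\<And>i. i \<in> {1..n} \<Longrightarrow> x i = l * y i"
  shows "card {s. eval_form n d c (x(0 := s)) = 0} = card {s. eval_form n d c (y(0 := s)) = 0}"
proof -
  have eq: "eval_form n d c (x(0 := l * s)) = l ^ d * eval_form n d c (y(0 := s))" for s
  proof -
    have "eval_form n d c (x(0 := l * s)) = eval_form n d c (\<lambda>i. l * (y(0 := s)) i)"
      unfolding eval_form_def by (intro sum.cong refl arg_cong2[of _ _ _ _ "(*)"] prod.cong)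
        (use assms(2) in auto)
    then show ?thesis by (simp only: eval_form_homogeneous)
  qed
  have "{s. eval_form n d c (x(0 := s)) = 0} = (*) l ` {s. eval_form n d c (y(0 := s)) = 0}"
  proof (intro equalityI subsetI)
    fix s assume "s \<in> {s. eval_form n d c (x(0 := s)) = 0}"
    then show "s \<in> (*) l ` {s. eval_form n d c (y(0 := s)) = 0}"
      using eq[of "s / l"] assms(1) by (auto intro!: image_eqI[of _ _ "s / l"])
  qed (use eq in auto)
  then show ?thesis
    using assms(1) by (simp add: card_image inj_on_def)
qed

text \<open>
  The coefficient families that satisfy both conditions over compact sets. The nonzero forms
  among them are exactly those whose divisor lies in \<^term>\<open>Div'' n d\<close> (\<open>class_in_Div''_iff\<close>).
\<close>

definition good_forms :: "nat \<Rightarrow> nat \<Rightarrow> form set" where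
  "good_forms n d =
     {c. \<forall>t\<in>{0..1}. eval_form n d c (\<lambda>i. if i = 0 then 1 else if i = 1 then t else 0) \<noteq> 0} \<inter>
     {c. \<forall>x\<in>max_sphere n. (c, x) \<in> real_rooted_pairs n d}"

lemma open_good_forms: "open (good_forms n d)"
proof -
  let ?W = "{z :: form \<times> real. eval_form n d (fst z)
      (\<lambda>i. if i = 0 then 1 else if i = 1 then snd z else 0) \<noteq> 0}"
  have "continuous_on UNIV (\<lambda>z :: form \<times> real. if i = 0 then 1 else if i = 1 then snd z else 0)"
    for i :: nat
    by (cases "i = 0"; cases "i = 1") (auto intro!: continuous_intros)
  then have "open ?W"
    by (intro open_Collect_neq continuous_intros)
  from open_Ball_compact[OF _ this, of "{0..1}"]
  have "open {c. \<forall>t\<in>{0..1}. eval_form n d c (\<lambda>i. if i = 0 then 1 else if i = 1 then t else 0) \<noteq> 0}"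
    by (simp only: mem_Collect_eq fst_conv snd_conv compact_Icc simp_thms)
  then show ?thesis
    unfolding good_forms_def
    by (intro open_Int open_Ball_compact compact_max_sphere open_real_rooted)
qed

text \<open>
  The same conditions over the non-compact parameter ranges \<open>\<real>\<^sup>n - {0}\<close> and \<open>(0, 1]\<close> that occur
  in the definition of \<^const>\<open>Div''\<close>.
\<close>

lemma good_forms_iff:
  "c \<in> good_forms n d \<longleftrightarrow> c (top_exponent d) \<noteq> 0 \<and>
     (\<forall>x. (\<exists>i\<in>{1..n}. x i \<noteq> 0) \<longrightarrow> card {s. eval_form n d c (x(0 := s)) = 0} = d) \<and>
     (\<forall>t\<in>{0<..1}. eval_form n d c (\<lambda>i. if i = 0 then 1 / t else if i = 1 then 1 else 0) \<noteq> 0)"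
  (is "_ \<longleftrightarrow> ?top \<and> ?roots \<and> ?ray")
proof -
  let ?v = "\<lambda>t :: real. \<lambda>i :: nat. if i = 0 then 1 else if i = 1 then t else 0"
  \<comment> \<open>At \<open>t = 0\<close> the point is \<open>(1, 0, \<dots>, 0)\<close>, where only \<open>x\<^sub>0\<^sup>d\<close> contributes.\<close>
  have zero: "eval_form n d c (?v 0) = c (top_exponent d)"
    by (subst eval_form_axis) auto
  have pos: "eval_form n d c (?v t) =
      t ^ d * eval_form n d c (\<lambda>i. if i = 0 then 1 / t else if i = 1 then 1 else 0)" if "t > 0" for t
    by (subst eval_form_homogeneous[symmetric])
      (use that in \<open>auto intro!: arg_cong[where f = "eval_form n d c"]\<close>)
  have "(\<forall>t\<in>{0..1}. eval_form n d c (?v t) \<noteq> 0) \<longleftrightarrow>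
      eval_form n d c (?v 0) \<noteq> 0 \<and> (\<forall>t\<in>{0<..1}. eval_form n d c (?v t) \<noteq> 0)"
  proof -
    have "{0..1} = insert 0 {0<..1::real}" by auto
    then show ?thesis by simp
  qed
  also have "\<dots> \<longleftrightarrow> ?top \<and> ?ray" unfolding zero using pos by auto
  finally have ray: "(\<forall>t\<in>{0..1}. eval_form n d c (?v t) \<noteq> 0) \<longleftrightarrow> ?top \<and> ?ray" .
  have roots: "(\<forall>x\<in>max_sphere n. (c, x) \<in> real_rooted_pairs n d) \<longleftrightarrow> ?roots" if ?top
  proof
    assume L: "\<forall>x\<in>max_sphere n. (c, x) \<in> real_rooted_pairs n d"
    show ?roots
    proof (intro allI impI)
      fix x :: "nat \<Rightarrow> real" assume "\<exists>i\<in>{1..n}. x i \<noteq> 0"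
      then obtain l y where "l > 0" "y \<in> max_sphere n" "\<And>i. i \<in> {1..n} \<Longrightarrow> x i = l * y i"
        using scaled_to_max_sphere by blast
      then show "card {s. eval_form n d c (x(0 := s)) = 0} = d"
        using L card_roots_scale[of l n x y d c] by (auto simp: real_rooted_pairs_def)
    qed
  next
    assume R: ?roots
    have "\<exists>i\<in>{1..n}. x i \<noteq> 0" if "x \<in> max_sphere n" for x
      using that unfolding max_sphere_def by force
    then show "\<forall>x\<in>max_sphere n. (c, x) \<in> real_rooted_pairs n d"
      using R \<open>?top\<close> by (auto simp: real_rooted_pairs_def)
  qed
  show ?thesis
    unfolding good_forms_def using ray roots by auto
qed

section \<open>Descent to divisors\<close>

lemma openin_form_topology:
  assumes "open U"
  shows "openin (form_topology n d) {c \<in> topspace (form_topology n d). c \<in> U}"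
proof -
  have "continuous_map (form_topology n d) (product_topology (\<lambda>_. euclidean) UNIV) (\<lambda>c. c)"
    unfolding continuous_map_componentwise_UNIV
  proof
    fix \<alpha>
    show "continuous_map (form_topology n d) euclideanreal (\<lambda>c. c \<alpha>)"
    proof (cases "\<alpha> \<in> exponents n d")
      case True
      then show ?thesis unfolding form_topology_def by (rule continuous_map_product_projection)
    next
      case False
      \<comment> \<open>Outside the exponents, families are extensional, so this coordinate is constant.\<close>
      have "continuous_map (form_topology n d) euclideanreal (\<lambda>c. undefined)" by simp
      then show ?thesis
        by (rule continuous_map_eq) (use False in \<open>auto simp: form_topology_def PiE_def extensional_def\<close>)
    qed
  qed
  from openin_continuous_map_preimage[OF this, of U] assms show ?thesis
    by (simp add: euclidean_product_topology)
qed

lemma class_in_Div'_iff: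
  assumes c: "c \<in> nonzero_forms n d"
  shows "proportional n d `` {c} \<in> Div' n d \<longleftrightarrow> c (top_exponent d) \<noteq> 0"
proof
  assume "proportional n d `` {c} \<in> Div' n d"
  then obtain G where "(c, G) \<in> proportional n d" "G (top_exponent d) = 1"
    by (auto simp: Div'_def)
  then show "c (top_exponent d) \<noteq> 0"
    using top_exponent_in_exponents[of d n] by (auto simp: proportional_def)
next
  assume top: "c (top_exponent d) \<noteq> 0"
  define G where "G = (\<lambda>\<alpha>\<in>exponents n d. inverse (c (top_exponent d)) * c \<alpha>)"
  have G1: "G (top_exponent d) = 1"
    using top top_exponent_in_exponents[of d n] by (simp add: G_def)
  have "G \<in> nonzero_forms n d"
    using G1 top_exponent_in_exponents[of d n]
    by (auto simp: nonzero_forms_def form_topology_def G_def intro!: bexI[of _ "top_exponent d"])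
  then have "(c, G) \<in> proportional n d"
    using c top by (auto simp: proportional_def G_def intro!: exI[of _ "inverse (c (top_exponent d))"])
  then show "proportional n d `` {c} \<in> Div' n d"
    using G1 c by (auto simp: Div'_def Div_def quotientI)
qed

lemma class_in_Div''_iff:
  assumes c: "c \<in> nonzero_forms n d"
  shows "proportional n d `` {c} \<in> Div'' n d \<longleftrightarrow> c \<in> good_forms n d"
proof (cases "c (top_exponent d) = 0")
  case True
  then have "proportional n d `` {c} \<notin> Div' n d" using class_in_Div'_iff[OF c] by simp
  then show ?thesis using True by (auto simp: Div''_def E_div_def good_forms_iff)
next
  case False
  let ?D = "proportional n d `` {c}"
  define G where "G = normalized d ?D"
  have D: "?D \<in> Div' n d" using class_in_Div'_iff[OF c] False by simp
  have "G \<in> ?D"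
    using theI'[OF ex1_normalized[OF D]] by (simp add: G_def normalized_def)
  then obtain r where r: "r \<noteq> 0" "\<And>\<alpha>. \<alpha> \<in> exponents n d \<Longrightarrow> G \<alpha> = r * c \<alpha>"
    by (auto simp: proportional_def)
  have G0: "eval_form n d G x = 0 \<longleftrightarrow> eval_form n d c x = 0" for x
    using eval_form_scale[of n d G r c x] r by simp
  have fin: "finite {s. eval_form n d c (x(0 := s)) = 0}" for x
    using poly_roots_finite[OF form_poly_nonzero(1)[of c d n x, OF False]] by (simp add: poly_form_poly)
  have ray: "rescale n d G t (\<lambda>i. if i = 0 \<or> i = 1 then 1 else 0) \<noteq> 0 \<longleftrightarrow>
      eval_form n d c (\<lambda>i. if i = 0 then 1 / t else if i = 1 then 1 else 0) \<noteq> 0"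
    if "t \<in> {0<..1}" for t
  proof -
    have "(\<lambda>i :: nat. if i = 0 \<or> i = 1 then 1 else 0)(0 := (1 / t) * 1) =
        (\<lambda>i. if i = 0 then 1 / t else if i = 1 then 1 else 0)"
      by auto
    then show ?thesis using that by (simp add: rescale_def G0)
  qed
  show ?thesis
    using D False fin ray
    by (simp add: Div''_def E_div_def good_forms_iff Let_def G_def[symmetric] G0)
qed

theorem proposition6p3:
  fixes n d :: nat
  assumes "n \<ge> 1"
  shows "openin (Div_topology n d) (Div'' n d)"
  unfolding openin_Div_topology
proof
  show "Div'' n d \<subseteq> Div n d"
    by (auto simp: Div''_def E_div_def Div'_def)
  have "{c \<in> nonzero_forms n d. proportional n d `` {c} \<in> Div'' n d} =
      {c \<in> topspace (form_topology n d). c \<in> good_forms n d} \<inter> nonzero_forms n d"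
    using class_in_Div''_iff by (auto simp: nonzero_forms_def)
  then show "openin (subtopology (form_topology n d) (nonzero_forms n d))
      {c \<in> nonzero_forms n d. proportional n d `` {c} \<in> Div'' n d}"
    using openin_form_topology[OF open_good_forms] by (simp only: openin_subtopology_Int)
qed

end
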